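(* Let $k\ge 1$ and $n\ge 1$ be integers. The $(k+1)$-tuples of statistics $(\mathrm{pk}_0,\mathrm{pk}_1,\dots,\mathrm{pk}_{k-1},\mathrm{dd})$ on $\mathcal{P}^k_n$ and $(e_1,e_2,\dots,e_{k+1})$ on $\mathcal{T}^{k+1}_n$ are (jointly) equidistributed. That is, for all nonnegative integers $r_0,\dots,r_k$, the number of $P\in\mathcal{P}^k_n$ with $(\mathrm{pk}_0,\dots,\mathrm{pk}_{k-1},\mathrm{dd})(P)=(r_0,\dots,r_k)$ equals the number of $T\in\mathcal{T}^{k+1}_n$ with $(e_1,\dots,e_{k+1})(T)=(r_0,\dots,r_k)$.
   Context: A $k$-Dyck path of down-size $n$ is a lattice path from $(0,0)$ to $((k+1)n,0)$ with steps $u=(1,1)$ and $d=(1,-k)$ that stays in the first quadrant (never goes below the $x$-axis). $\mathcal{P}^k_n$ is the set of all such paths. A peak is a block of two consecutive steps $ud$; its height is the second coordinate of the left endpoint of its $d$ step. A double descent is a block $dd$ of two consecutive steps. For $0\le i\le k-1$, $\mathrm{pk}_i(P)$ is the number of non-rightmost peaks of $P$ (all peaks except the last one) whose height is congruent to $i$ modulo $k$; $\mathrm{dd}(P)$ is the number of double descents of $P$. An $l$-ary tree is a rooted ordered tree in which each node has at most $l$ children, which are assigned distinct positions in $\{1,\dots,l\}$ from left to right, not necessarily consecutive. $\mathcal{T}^l_n$ is the set of $l$-ary trees with $n$ vertices. For $1\le i\le l$, $e_i(T)$ is the number of nodes of $T$ that are children in position $i$ (of their parent). *)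

theory Defs
  imports "HOL-Number_Theory.Cong"
begin

datatype step = U | D

fun rise :: "nat \<Rightarrow> step \<Rightarrow> int" where
  "rise k U = 1"
| "rise k D = - int k"

text \<open>Every step advances the first coordinate by one, so after \<open>j\<close> steps a path started at
  the origin is at the point \<open>(j, height k P j)\<close>.\<close>

definition height :: "nat \<Rightarrow> step list \<Rightarrow> nat \<Rightarrow> int" where
  "height k P j = sum_list (map (rise k) (take j P))"

definition dyck_paths :: "nat \<Rightarrow> nat \<Rightarrow> step list set" where
  "dyck_paths k n =
     {P. length P = (k + 1) * n \<and> height k P (length P) = 0 \<and>
         (\<forall>j \<le> length P. height k P j \<ge> 0)}"

text \<open>A peak or double descent is represented by the index \<open>j\<close> of the first of its two steps
  (counting steps from 0), so the left endpoint of its second step is reached after \<open>j + 1\<close>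
  steps.\<close>

definition peaks :: "step list \<Rightarrow> nat set" where
  "peaks P = {j. j + 1 < length P \<and> P ! j = U \<and> P ! (j + 1) = D}"

definition pk :: "nat \<Rightarrow> nat \<Rightarrow> step list \<Rightarrow> nat" where
  "pk k i P =
     card {j \<in> peaks P. (\<exists>j' \<in> peaks P. j < j') \<and> [height k P (j + 1) = int i] (mod int k)}"

definition dd :: "step list \<Rightarrow> nat" where
  "dd P = card {j. j + 1 < length P \<and> P ! j = D \<and> P ! (j + 1) = D}"

text \<open>A node carries one slot per position: the entry with list index \<open>i - 1\<close> is the child in
  position \<open>i\<close>, or \<open>None\<close> if that position is unoccupied. The empty tree is not represented.\<close>

datatype tree = Node "tree option list"

inductive lary :: "nat \<Rightarrow> tree \<Rightarrow> bool" for l where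
  "length cs = l \<Longrightarrow> (\<And>t. Some t \<in> set cs \<Longrightarrow> lary l t) \<Longrightarrow> lary l (Node cs)"

fun vertices :: "tree \<Rightarrow> nat" where
  "vertices (Node cs) = 1 + (\<Sum>c\<leftarrow>cs. case c of None \<Rightarrow> 0 | Some t \<Rightarrow> vertices t)"

definition lary_trees :: "nat \<Rightarrow> nat \<Rightarrow> tree set" where
  "lary_trees l n = {T. lary l T \<and> vertices T = n}"

fun children_at :: "nat \<Rightarrow> tree \<Rightarrow> nat" where
  "children_at i (Node cs) =
     of_bool (1 \<le> i \<and> i \<le> length cs \<and> cs ! (i - 1) \<noteq> None) +
     (\<Sum>c\<leftarrow>cs. case c of None \<Rightarrow> 0 | Some t \<Rightarrow> children_at i t)"

text \<open>Both families are finite, so \<open>card\<close> counts them and their subsets genuinely.\<close>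

lemma finite_dyck_paths: "finite (dyck_paths k n)"
proof (rule finite_subset)
  have UD: "x \<in> {U, D}" for x by (cases x) simp_all
  show "dyck_paths k n \<subseteq> {P. set P \<subseteq> {U, D} \<and> length P = (k + 1) * n}"
    unfolding dyck_paths_def using UD by blast
  show "finite {P. set P \<subseteq> {U, D} \<and> length P = (k + 1) * n}"
    by (rule finite_lists_length_eq) simp
qed

lemma finite_lary_trees: "finite (lary_trees l n)"
proof (induction n rule: less_induct)
  case (less n)
  let ?S = "insert None (Some ` (\<Union>m<n. lary_trees l m))"
  have sub: "lary_trees l n \<subseteq> Node ` {cs. set cs \<subseteq> ?S \<and> length cs = l}"
  proof
    fix T assume "T \<in> lary_trees l n"
    then have T: "lary l T" "vertices T = n" by (auto simp: lary_trees_def)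
    from T(1) obtain cs where cs: "T = Node cs" "length cs = l"
      "\<And>t. Some t \<in> set cs \<Longrightarrow> lary l t" by (cases rule: lary.cases) blast
    have "c \<in> ?S" if c: "c \<in> set cs" for c
    proof (cases c)
      case (Some t)
      have "(case c of None \<Rightarrow> 0 | Some t \<Rightarrow> vertices t) \<le>
            (\<Sum>c\<leftarrow>cs. case c of None \<Rightarrow> 0 | Some t \<Rightarrow> vertices t)"
        using c by (intro member_le_sum_list) auto
      then have "vertices t < n" using T(2) cs(1) Some by simp
      moreover have "lary l t" using c cs(3) Some by simp
      ultimately show ?thesis using Some by (auto simp: lary_trees_def)
    qed simp
    then show "T \<in> Node ` {cs. set cs \<subseteq> ?S \<and> length cs = l}" using cs(1,2) by blast
  qed
  have fin: "finite {cs. set cs \<subseteq> ?S \<and> length cs = l}"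
    using less.IH by (intro finite_lists_length_eq) auto
  show ?case by (rule finite_subset[OF sub finite_imageI[OF fin]])
qed

end

theory Submission
  imports Defs
begin

text \<open>
  The equidistribution is realised by a bijection that passes through lists of \<open>n\<close> rows of
  \<open>k + 1\<close> Booleans.

  A Dyck path \<open>P\<close> has \<open>k n\<close> up-steps and \<open>n\<close> down-steps. Record for each up-step whether a
  down-step follows it (the word \<open>ups P\<close>), and for each down-step whether a down-step precedes it
  (the word \<open>downs D P\<close>). Since a path is determined by its peaks, these two words determine \<open>P\<close>,
  and any two words occur for some sequence of steps as soon as both announce the same number of
  peaks and the last up-step is followed by a down-step. The last bit of \<open>ups P\<close> is always true
  and belongs to the rightmost peak; replacing it by a false bit in front gives a word \<open>V\<close> of
  length \<open>k n\<close> in which the bit with index \<open>v\<close>, \<open>0 \<le> v < k n\<close>, says whether a non-rightmost peak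
  comes after exactly \<open>v\<close> up-steps. The height of that peak is \<open>v\<close> modulo \<open>k\<close>, as a down-step does
  not change heights modulo \<open>k\<close>. Now cut \<open>V\<close> into \<open>n\<close> blocks of length \<open>k\<close> and append the \<open>m\<close>-th
  bit of \<open>downs D P\<close> to the \<open>m\<close>-th block. The columns \<open>0, \<dots>, k - 1\<close> of the resulting rows count the
  peaks by residue, and column \<open>k\<close> counts the double descents.

  The \<open>m\<close>-th down-step ends at nonnegative height iff at least \<open>k m\<close> up-steps precede it. Say that
  there are \<open>u\<close> of them; the \<open>u\<close>-th one starts a peak, and the number of peaks among the first \<open>u\<close>
  up-steps is \<open>m\<close> minus the number of double descents met so far. Hence \<open>k m - 1 < u\<close> iff the first
  \<open>m\<close> rows contain fewer than \<open>m\<close> true bits altogether (\<open>prefix_condition_iff\<close>). So Dyck paths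
  correspond to the row lists that satisfy this condition for all \<open>m\<close> and contain \<open>n - 1\<close> true bits
  in total (\<open>bij_betw_path_pair\<close>, \<open>bij_betw_rows\<close>).

  These row lists are also exactly the postorder codes of \<open>(k + 1)\<close>-ary trees, where a node
  contributes the row of its occupied positions: the condition says that the stack of completed
  subtrees never runs empty and ends with a single tree (\<open>bij_betw_code\<close>). The column counts of the
  code are the numbers of children in each position.
\<close>

section \<open>Counting\<close>

abbreviation trues :: "bool list \<Rightarrow> nat" where
  "trues b \<equiv> count_list b True"

lemma card_Collect_zero_Suc:
  assumes "finite {j. R j}"
  shows "card {j. R j} = of_bool (R 0) + card {j. R (Suc j)}"
proof -
  have split: "{j. R j} = (if R 0 then {0} else {}) \<union> Suc ` {j. R (Suc j)}" (is "_ = ?A \<union> ?B")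
  proof (rule set_eqI)
    show "x \<in> {j. R j} \<longleftrightarrow> x \<in> ?A \<union> ?B" for x by (cases x) auto
  qed
  have fin: "finite ?B" using assms unfolding split by simp
  have "card (?A \<union> ?B) = card ?A + card ?B"
    by (rule card_Un_disjoint) (use fin in auto)
  moreover have "card ?B = card {j. R (Suc j)}" by (simp add: card_image)
  ultimately show ?thesis using split by simp
qed

lemma card_Collect_less_add:
  "card {v. v < a + b \<and> R v} = card {v. v < a \<and> R v} + card {v. v < b \<and> R (a + v)}" for a b :: nat
proof -
  have split: "{v. v < a + b \<and> R v} = {v. v < a \<and> R v} \<union> (+) a ` {v. v < b \<and> R (a + v)}"
    (is "_ = ?A \<union> ?B")
  proof (rule set_eqI)
    fix x
    show "x \<in> {v. v < a + b \<and> R v} \<longleftrightarrow> x \<in> ?A \<union> ?B"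
    proof (cases "x < a")
      case False
      then obtain y where "x = a + y" using le_Suc_ex not_less by blast
      then show ?thesis by auto
    qed auto
  qed
  have "card (?A \<union> ?B) = card ?A + card ?B"
    by (rule card_Un_disjoint) auto
  moreover have "card ?B = card {v. v < b \<and> R (a + v)}" by (simp add: card_image)
  ultimately show ?thesis using split by simp
qed

lemma card_eq_of_bij_betw_stat:
  assumes f: "bij_betw f A B" and st: "\<And>a. a \<in> A \<Longrightarrow> t (f a) = s a"
  shows "card {a \<in> A. s a = r} = card {b \<in> B. t b = r}"
proof (rule bij_betw_same_card)
  show "bij_betw f {a \<in> A. s a = r} {b \<in> B. t b = r}"
    using f st by (auto simp: bij_betw_def inj_on_def image_iff)
qed

lemma trues_plus_falses: "count_list b True + count_list b False = length b"
  by (induction b) auto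

lemma count_list_take_mono: "a \<le> b \<Longrightarrow> count_list (take a xs) x \<le> count_list (take b xs) x"
proof -
  assume "a \<le> b"
  then have "take b xs = take a xs @ take (b - a) (drop a xs)"
    by (metis le_add_diff_inverse take_add)
  then show ?thesis by simp
qed

text \<open>As the bit at index \<open>u\<close> is true, a shorter prefix misses at least that bit.\<close>

lemma trues_take_less_iff:
  assumes "u < length X" "X ! u"
  shows "trues (take a X) < trues (take (Suc u) X) \<longleftrightarrow> a < Suc u"
proof
  assume "a < Suc u"
  then have "trues (take a X) \<le> trues (take u X)" by (intro count_list_take_mono) simp
  also have "\<dots> < trues (take (Suc u) X)" using assms by (simp add: take_Suc_conv_app_nth)
  finally show "trues (take a X) < trues (take (Suc u) X)" .
next
  assume less: "trues (take a X) < trues (take (Suc u) X)"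
  show "a < Suc u"
    using less count_list_take_mono[of "Suc u" a X True] by (meson not_less)
qed

section \<open>Trees and their postorder codes\<close>

text \<open>The postorder code of a tree lists, for every vertex, which of its positions are occupied. The
  children of a vertex are visited from right to left, so that in the stack of completed subtrees
  the leftmost child is on top.\<close>

fun code :: "tree \<Rightarrow> bool list list" where
  "code (Node cs) = concat (rev (map (case_option [] code) cs)) @ [map (\<lambda>c. c \<noteq> None) cs]"

text \<open>The total number of true bits, that is, of children announced by the rows.\<close>

definition weight :: "bool list list \<Rightarrow> nat" where
  "weight bs = sum_list (map trues bs)"

lemma weight_simps [simp]:
  "weight [] = 0" "weight (b # bs) = trues b + weight bs" "weight (bs @ bs') = weight bs + weight bs'"
  by (simp_all add: weight_def)

text \<open>Every nonempty prefix announces fewer children than it has rows: a stack machine that replaces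
  the announced number of subtrees by one new tree for each row never runs out of subtrees and
  always leaves a nonempty stack.\<close>

definition ballot :: "bool list list \<Rightarrow> bool" where
  "ballot bs \<longleftrightarrow> (\<forall>m \<in> {1..length bs}. weight (take m bs) < m)"

text \<open>The row lists that will turn out to be the codes of the \<open>l\<close>-ary trees with \<open>n\<close> vertices.\<close>

definition codes :: "nat \<Rightarrow> nat \<Rightarrow> bool list list set" where
  "codes l n = {bs. length bs = n \<and> (\<forall>b \<in> set bs. length b = l) \<and> ballot bs \<and> Suc (weight bs) = n}"

text \<open>The number of rows in which the bit with index \<open>i\<close> (counted from 0) is true.\<close>

definition column :: "nat \<Rightarrow> bool list list \<Rightarrow> nat" where
  "column i bs = length (filter (\<lambda>b. b ! i) bs)"

lemma column_simps [simp]: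
  "column i [] = 0" "column i (b # bs) = of_bool (b ! i) + column i bs"
  "column i (bs @ bs') = column i bs + column i bs'"
  by (simp_all add: column_def)

lemma ballot_Nil [simp]: "ballot []"
  by (simp add: ballot_def)

lemma ballot_weight_le: "ballot bs \<Longrightarrow> weight bs \<le> length bs"
  by (cases bs) (force simp: ballot_def dest: bspec[where x = "length bs"])+

lemma ballot_append: 
  assumes "ballot bs" "ballot bs'"
  shows "ballot (bs @ bs')"
  unfolding ballot_def
proof
  fix m assume m: "m \<in> {1..length (bs @ bs')}"
  show "weight (take m (bs @ bs')) < m"
  proof (cases "m \<le> length bs")
    case True
    then show ?thesis using assms m by (auto simp: ballot_def)
  next
    case False
    then have "m - length bs \<in> {1..length bs'}" using m by auto
    then have "weight (take (m - length bs) bs') < m - length bs"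
      using assms(2) unfolding ballot_def by blast
    then show ?thesis using False ballot_weight_le[OF assms(1)] by simp
  qed
qed

lemma ballot_snoc: "ballot (bs @ [b]) \<longleftrightarrow> ballot bs \<and> weight bs + trues b \<le> length bs"
proof -
  have "{1..length (bs @ [b])} = insert (Suc (length bs)) {1..length bs}" by auto
  then show ?thesis by (auto simp: ballot_def)
qed

lemma lary_Node: "lary l (Node cs) \<longleftrightarrow> length cs = l \<and> (\<forall>t. Some t \<in> set cs \<longrightarrow> lary l t)"
  by (subst lary.simps) auto

lemma length_code: "length (code T) = vertices T"
proof (induction T)
  case (Node cs)
  have "length (case_option [] code c) = (case c of None \<Rightarrow> 0 | Some t \<Rightarrow> vertices t)" if "c \<in> set cs" for c
    using Node[OF that] by (auto split: option.splits)
  then have "(\<Sum>c\<leftarrow>cs. length (case_option [] code c)) = (\<Sum>c\<leftarrow>cs. case c of None \<Rightarrow> 0 | Some t \<Rightarrow> vertices t)"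
    by (intro arg_cong[where f = sum_list] map_cong) auto
  then show ?case by (simp add: length_concat rev_map[symmetric] sum_list_rev comp_def)
qed

lemma code_row_lengths: "(\<forall>b \<in> set (code T). length b = l) \<longleftrightarrow> lary l T"
proof (induction T)
  case (Node cs)
  have "(\<forall>b \<in> set (case_option [] code c). length b = l) \<longleftrightarrow> (\<forall>t. c = Some t \<longrightarrow> lary l t)"
    if "c \<in> set cs" for c using Node[OF that] by (auto split: option.splits)
  then show ?case by (auto simp: lary_Node)
qed

lemma column_concat_rev: "column i (concat (rev bss)) = (\<Sum>bs\<leftarrow>bss. column i bs)"
  by (induction bss) auto

lemma column_code:
  assumes "lary l T" "i < l"
  shows "column i (code T) = children_at (Suc i) T"
  using assms
proof (induction T rule: tree.induct)
  case (Node cs)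
  have "column i (case_option [] code c) = (case c of None \<Rightarrow> 0 | Some t \<Rightarrow> children_at (Suc i) t)"
    if "c \<in> set cs" for c
    using Node that by (auto simp: lary_Node split: option.splits)
  then have "(\<Sum>c\<leftarrow>cs. column i (case_option [] code c)) =
      (\<Sum>c\<leftarrow>cs. case c of None \<Rightarrow> 0 | Some t \<Rightarrow> children_at (Suc i) t)"
    by (intro arg_cong[where f = sum_list] map_cong) auto
  then show ?case using Node.prems by (simp add: column_concat_rev comp_def lary_Node)
qed

lemma code_ballot: "ballot (code T) \<and> Suc (weight (code T)) = length (code T)"
proof (induction T)
  case (Node cs)
  have *: "ballot (concat (rev (map (case_option [] code) cs))) \<and>
        weight (concat (rev (map (case_option [] code) cs))) + trues (map (\<lambda>c. c \<noteq> None) cs)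
         = length (concat (rev (map (case_option [] code) cs)))"
    using Node
  proof (induction cs)
    case (Cons c cs)
    have IH: "ballot (concat (rev (map (case_option [] code) cs)))" 
      "weight (concat (rev (map (case_option [] code) cs))) + trues (map (\<lambda>c. c \<noteq> None) cs)
         = length (concat (rev (map (case_option [] code) cs)))"
      using Cons by auto
    show ?case
    proof (cases c)
      case None
      then show ?thesis using IH by simp
    next
      case (Some t)
      then have "ballot (code t)" "Suc (weight (code t)) = length (code t)" using Cons.prems[of c t] by auto
      then show ?thesis using IH Some ballot_append by simp
    qed
  qed simp
  then show ?case by (simp add: ballot_snoc)
qed

text \<open>Distribute trees from the list, in order, to the true positions of a row. The last equation, for
  a list that is too short, is a default that ballot sequences never reach.\<close>

fun fill :: "bool list \<Rightarrow> tree list \<Rightarrow> tree option list" where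
  "fill [] ts = []"
| "fill (False # b) ts = None # fill b ts"
| "fill (True # b) (t # ts) = Some t # fill b ts"
| "fill (True # b) [] = []"

text \<open>One step of the stack machine: take the children announced by the row \<open>b\<close> from the top of the
  stack (the head of the list) and push the vertex that carries them.\<close>

definition graft :: "bool list \<Rightarrow> tree list \<Rightarrow> tree list" where
  "graft b ts = Node (fill b ts) # drop (trues b) ts"

text \<open>Running the stack machine on the code of a tree pushes that tree; hence codes are injective.\<close>

lemma fold_graft_code: "fold graft (code T) ts = T # ts"
proof (induction T arbitrary: ts)
  case (Node cs)
  define present where "present = (\<lambda>cs :: tree option list. map the (filter (\<lambda>c. c \<noteq> None) cs))"
  have kids: "fold graft (concat (rev (map (case_option [] code) cs))) ts = present cs @ ts" for ts
    using Node
  proof (induction cs arbitrary: ts)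
    case (Cons c cs)
    then show ?case by (cases c) (auto simp: present_def)
  qed (simp add: present_def)
  have fill: "fill (map (\<lambda>c. c \<noteq> None) cs) (present cs @ ts) = cs" for cs
    by (induction cs) (auto simp: present_def)
  have drop: "drop (trues (map (\<lambda>c. c \<noteq> None) cs)) (present cs @ ts) = ts" for cs
    by (induction cs) (auto simp: present_def)
  have "graft (map (\<lambda>c. c \<noteq> None) cs) (present cs @ ts) = Node cs # ts"
    by (simp only: graft_def fill drop)
  then show ?case using kids by simp
qed

lemma occupied_fill: "trues b \<le> length ts \<Longrightarrow> map (\<lambda>c. c \<noteq> None) (fill b ts) = b"
  by (induction b ts rule: fill.induct) auto

lemma concat_code_fill:
  "trues b \<le> length ts \<Longrightarrow>
    concat (rev (map (case_option [] code) (fill b ts))) = concat (rev (map code (take (trues b) ts)))"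
  by (induction b ts rule: fill.induct) auto

text \<open>Conversely, every ballot sequence is recovered from the forest left on the stack, whose size is
  the number of rows minus their weight.\<close>

lemma concat_code_fold_graft:
  assumes "ballot bs"
  shows "concat (rev (map code (fold graft bs []))) = bs
    \<and> length (fold graft bs []) + weight bs = length bs"
  using assms
proof (induction bs rule: rev_induct)
  case (snoc b bs)
  define ts where "ts = fold graft bs []"
  have IH: "concat (rev (map code ts)) = bs" "length ts + weight bs = length bs"
    and le: "trues b \<le> length ts"
    using snoc by (auto simp: ballot_snoc ts_def)
  have "concat (rev (map code ts)) = 
    concat (rev (map code (drop (trues b) ts))) @ concat (rev (map code (take (trues b) ts)))"
    by (metis append_take_drop_id concat_append map_append rev_append)
  then have "concat (rev (map code (graft b ts))) = bs @ [b]"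
    using le by (simp add: graft_def concat_code_fill occupied_fill IH(1) del: not_None_eq)
  moreover have "length (graft b ts) + weight (bs @ [b]) = length (bs @ [b])"
    using IH(2) le by (simp add: graft_def)
  moreover have "fold graft (bs @ [b]) [] = graft b ts" by (simp add: ts_def)
  ultimately show ?case by simp
qed simp

lemma bij_betw_code: "bij_betw code (lary_trees l n) (codes l n)"
  unfolding bij_betw_def
proof
  show "inj_on code (lary_trees l n)"
    by (rule inj_on_inverseI[where g = "\<lambda>bs. hd (fold graft bs [])"]) (simp add: fold_graft_code)
  show "code ` lary_trees l n = codes l n"
  proof (intro equalityI subsetI)
    fix bs assume "bs \<in> code ` lary_trees l n"
    then obtain T where T: "bs = code T" "lary l T" "vertices T = n" by (auto simp: lary_trees_def)
    then show "bs \<in> codes l n"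
      using code_ballot[of T] code_row_lengths[of T l] length_code[of T] by (auto simp: codes_def)
  next
    fix bs assume bs: "bs \<in> codes l n"
    then have "length (fold graft bs []) = 1" "concat (rev (map code (fold graft bs []))) = bs"
      using concat_code_fold_graft[of bs] by (auto simp: codes_def)
    then obtain T where "code T = bs" by (auto simp: length_Suc_conv)
    moreover from this have "T \<in> lary_trees l n"
      using bs code_row_lengths[of T l] length_code[of T] by (auto simp: codes_def lary_trees_def)
    ultimately show "bs \<in> code ` lary_trees l n" by blast
  qed
qed

section \<open>Cutting a word into rows\<close>

text \<open>The two words of a path: \<open>V\<close> marks the numbers of up-steps after which a non-rightmost peak
  occurs, and \<open>Y\<close> marks the down-steps that follow another down-step. The conditions are those
  of \<open>codes\<close> in terms of \<open>V\<close> and \<open>Y\<close>.\<close>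

definition word_pairs :: "nat \<Rightarrow> nat \<Rightarrow> (bool list \<times> bool list) set" where
  "word_pairs k n = {(V, Y). length V = k * n \<and> length Y = n \<and>
     (\<forall>m \<in> {1..n}. trues (take (k * m) V) + trues (take m Y) < m) \<and> Suc (trues V + trues Y) = n}"

text \<open>Cut \<open>V\<close> into blocks of length \<open>k\<close> and append one bit of \<open>Y\<close> to each block.\<close>

fun rows :: "nat \<Rightarrow> bool list \<Rightarrow> bool list \<Rightarrow> bool list list" where
  "rows k V [] = []"
| "rows k V (y # Y) = (take k V @ [y]) # rows k (drop k V) Y"

lemma length_rows [simp]: "length (rows k V Y) = length Y"
  by (induction k V Y rule: rows.induct) auto

lemma row_length: "length V = k * length Y \<Longrightarrow> b \<in> set (rows k V Y) \<Longrightarrow> length b = Suc k"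
  by (induction k V Y rule: rows.induct) auto

lemma map_last_rows: "map last (rows k V Y) = Y"
  by (induction k V Y rule: rows.induct) auto

lemma concat_butlast_rows: "length V = k * length Y \<Longrightarrow> concat (map butlast (rows k V Y)) = V"
  by (induction k V Y rule: rows.induct) auto

lemma rows_concat_butlast:
  "(\<And>b. b \<in> set bs \<Longrightarrow> length b = Suc k) \<Longrightarrow> rows k (concat (map butlast bs)) (map last bs) = bs"
proof (induction bs)
  case (Cons b bs)
  then have "length b = Suc k" by simp
  moreover from this have "b \<noteq> []" by auto
  ultimately show ?case using Cons by simp
qed simp

lemma weight_take_rows:
  "length V = k * length Y \<Longrightarrow> m \<le> length Y \<Longrightarrow> 
    weight (take m (rows k V Y)) = trues (take (k * m) V) + trues (take m Y)"
proof (induction k V Y arbitrary: m rule: rows.induct)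
  case (2 k V y Y)
  show ?case
  proof (cases m)
    case (Suc m')
    have "take (k * m) V = take k V @ take (k * m') (drop k V)"
      by (simp add: Suc take_add)
    then show ?thesis using 2 Suc by simp
  qed simp
qed simp

lemma column_rows:
  "length V = k * length Y \<Longrightarrow> i < k \<Longrightarrow>
    column i (rows k V Y) = card {v. v < k * length Y \<and> V ! v \<and> v mod k = i}"
proof (induction k V Y rule: rows.induct)
  case (2 k V y Y)
  have "{v. v < k \<and> V ! v \<and> v mod k = i} = (if V ! i then {i} else {})"
    using 2 by auto
  then have "card {v. v < k \<and> V ! v \<and> v mod k = i} = of_bool (V ! i)" by simp
  moreover have "{v. v < k * length Y \<and> drop k V ! v \<and> v mod k = i}
      = {v. v < k * length Y \<and> V ! (k + v) \<and> (k + v) mod k = i}"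
    using 2 by auto
  ultimately show ?case
    using 2 card_Collect_less_add[of k "k * length Y" "\<lambda>v. V ! v \<and> v mod k = i"]
    by (simp add: nth_append)
qed simp

lemma column_last_rows: "length V = k * length Y \<Longrightarrow> column k (rows k V Y) = trues Y"
  by (induction k V Y rule: rows.induct) (auto simp: nth_append)

lemma rows_mem_codes_iff:
  assumes "length V = k * n" "length Y = n"
  shows "rows k V Y \<in> codes (Suc k) n \<longleftrightarrow> (V, Y) \<in> word_pairs k n"
proof -
  have "weight (take m (rows k V Y)) = trues (take (k * m) V) + trues (take m Y)" if "m \<le> n" for m
    using assms that weight_take_rows by simp
  from this this[of n] show ?thesis
    using assms row_length[of V k Y] by (auto simp: codes_def word_pairs_def ballot_def)
qed

lemma bij_betw_rows: "bij_betw (\<lambda>(V, Y). rows k V Y) (word_pairs k n) (codes (Suc k) n)"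
proof (rule bij_betw_byWitness[where f' = "\<lambda>bs. (concat (map butlast bs), map last bs)"])
  show "\<forall>p \<in> word_pairs k n.
      (concat (map butlast (case p of (V, Y) \<Rightarrow> rows k V Y)), map last (case p of (V, Y) \<Rightarrow> rows k V Y)) = p"
    by (auto simp: word_pairs_def map_last_rows concat_butlast_rows)
  show "\<forall>bs \<in> codes (Suc k) n. 
      (case (concat (map butlast bs), map last bs) of (V, Y) \<Rightarrow> rows k V Y) = bs"
    by (auto simp: codes_def rows_concat_butlast)
  show "(\<lambda>(V, Y). rows k V Y) ` word_pairs k n \<subseteq> codes (Suc k) n"
    using rows_mem_codes_iff by (auto simp: word_pairs_def)
  show "(\<lambda>bs. (concat (map butlast bs), map last bs)) ` codes (Suc k) n \<subseteq> word_pairs k n"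
  proof
    fix p assume "p \<in> (\<lambda>bs. (concat (map butlast bs), map last bs)) ` codes (Suc k) n"
    then obtain bs where bs: "bs \<in> codes (Suc k) n" and p: "p = (concat (map butlast bs), map last bs)" by blast
    have "length (concat (map butlast bs)) = k * n" 
    proof -
      have "\<forall>b \<in> set bs. length b = Suc k" using bs by (simp add: codes_def)
      then have "length (concat (map butlast bs)) = k * length bs" by (induction bs) auto
      then show ?thesis using bs by (simp add: codes_def)
    qed
    moreover have "rows k (concat (map butlast bs)) (map last bs) = bs"
      using bs by (auto simp: codes_def rows_concat_butlast)
    ultimately show "p \<in> word_pairs k n"
      using rows_mem_codes_iff[of "concat (map butlast bs)" k n "map last bs"] bs p by (simp add: codes_def)
  qed
qed

section \<open>Paths and pairs of words\<close>

text \<open>For each up-step, whether it is followed by a down-step.\<close>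

fun ups :: "step list \<Rightarrow> bool list" where
  "ups [] = []"
| "ups (D # w) = ups w"
| "ups (U # w) = (w \<noteq> [] \<and> hd w = D) # ups w"

text \<open>For each down-step, whether it is preceded by a down-step, where the step before the path counts
  as \<open>s\<close>.\<close>

fun downs :: "step \<Rightarrow> step list \<Rightarrow> bool list" where
  "downs s [] = []"
| "downs s (U # w) = downs U w"
| "downs s (D # w) = (s = D) # downs D w"

text \<open>The inverse reconstruction. A false bit at the head of \<open>Y\<close> is the next down-step, which has to
  wait for the up-step that it follows; a true bit is emitted at once. The last two equations are
  the end of the word and defaults for unmatched bits.\<close>

fun word :: "bool list \<Rightarrow> bool list \<Rightarrow> step list" where
  "word X (True # Y) = D # word X Y"
| "word (False # X) (False # Y) = U # word X (False # Y)"
| "word (True # X) (False # Y) = U # D # word X Y"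
| "word [] (False # Y) = []"
| "word X [] = []"

lemma step_neq_iff [simp]: "s \<noteq> U \<longleftrightarrow> s = D" "s \<noteq> D \<longleftrightarrow> s = U"
  by (cases s; simp)+

lemma length_ups [simp]: "length (ups w) = count_list w U"
  by (induction w rule: ups.induct) auto

lemma length_downs [simp]: "length (downs s w) = count_list w D"
  by (induction s w rule: downs.induct) auto

lemma length_eq_count_steps: "length w = count_list w U + count_list w D"
  by (induction w rule: ups.induct) auto

text \<open>The words of a prefix that ends in a down-step are prefixes of the words of the path.\<close>

lemma ups_append: "p = [] \<or> last p = D \<Longrightarrow> ups (p @ q) = ups p @ ups q"
  by (induction p rule: ups.induct) (auto simp: hd_append split: if_splits)

lemma downs_append: "p = [] \<or> last p = D \<Longrightarrow> downs D (p @ q) = downs D p @ downs D q"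
proof -
  have "downs s (p @ q) = downs s p @ downs (last (s # p)) q" for s
    by (induction s p rule: downs.induct) auto
  then show "p = [] \<or> last p = D \<Longrightarrow> ?thesis" by auto
qed

lemma ups_last: "last w = D \<Longrightarrow> ups w \<noteq> [] \<Longrightarrow> last (ups w)"
proof (induction w rule: ups.induct)
  case (3 w)
  then show ?case by (cases w rule: ups.cases) auto
qed (auto split: if_splits)

text \<open>Both sides count peaks.\<close>

lemma trues_ups_eq_falses_downs:
  "w = [] \<or> last w = D \<Longrightarrow> trues (ups w) = count_list (downs D w) False"
proof -
  \<comment> \<open>For a preceding up-step, a down-step at the head of \<open>w\<close> completes one more peak.\<close>
  have "w = [] \<or> last w = D \<Longrightarrow> 
    trues (ups w) + of_bool (s = U \<and> w \<noteq> [] \<and> hd w = D) = count_list (downs s w) False" for s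
    by (induction s w rule: downs.induct) (auto split: if_splits)
  from this[of D] show "w = [] \<or> last w = D \<Longrightarrow> ?thesis" by simp
qed

lemma word_ups_downs: "w = [] \<or> last w = D \<Longrightarrow> word (ups w) (downs D w) = w"
proof (induction "length w" arbitrary: w rule: less_induct)
  case less
  show ?case
  proof (cases w rule: ups.cases)
    case (2 v)
    then show ?thesis using less by (auto split: if_splits)
  next
    case (3 v)
    then obtain s v' where v: "v = s # v'" using less.prems by (cases v) auto
    show ?thesis
    proof (cases s)
      case D
      then show ?thesis using 3 v less by (auto split: if_splits)
    next
      case U
      have last: "last v = D" using less.prems 3 v by simp
      then have IH: "word (ups v) (downs D v) = v" using less.hyps[of v] 3 by simp
      have "D \<in> set v'" using last v U by (cases v' rule: rev_cases) auto
      moreover have "\<exists>Y. downs U v' = False # Y" if "D \<in> set v'" for v'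
        using that by (induction v' rule: ups.induct) auto
      ultimately obtain Y where "downs U v' = False # Y" by blast
      then show ?thesis using IH 3 v U by simp
    qed
  qed simp
qed

lemma trues_pos: "X \<noteq> [] \<Longrightarrow> last X \<Longrightarrow> trues X \<noteq> 0"
  using last_in_set[of X] by (simp add: count_list_0_iff)

lemma word_eq_Nil_iff: "X = [] \<or> last X \<Longrightarrow> trues X = count_list Y False \<Longrightarrow> word X Y = [] \<longleftrightarrow> X = [] \<and> Y = []"
  by (induction X Y rule: word.induct) (auto split: if_splits dest: trues_pos)

lemma word_inverse:
  "X = [] \<or> last X \<Longrightarrow> trues X = count_list Y False \<Longrightarrow>
    ups (word X Y) = X \<and> downs D (word X Y) = Y \<and> (word X Y = [] \<or> last (word X Y) = D)"
proof (induction X Y rule: word.induct)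
  case (2 X Y)
  then have X: "X \<noteq> []" "last X" by (auto split: if_splits)
  then have IH: "ups (word X (False # Y)) = X" "downs D (word X (False # Y)) = False # Y"
    "last (word X (False # Y)) = D"
    using 2 word_eq_Nil_iff[of X "False # Y"] by auto
  then obtain v where "word X (False # Y) = U # v"
    by (cases "word X (False # Y)" rule: ups.cases) auto
  then show ?case using IH by simp
next
  case (5 X)
  then show ?case using trues_pos[of X] by auto
qed (auto split: if_splits)

lemma height_eq: "height k P j = int (count_list (take j P) U) - int k * int (count_list (take j P) D)"
proof -
  have "sum_list (map (rise k) w) = int (count_list w U) - int k * int (count_list w D)" for w
    by (induction w rule: ups.induct) (auto simp: algebra_simps)
  then show ?thesis by (simp add: height_def)
qed

text \<open>Only down-steps can lead below the axis, so it is enough to compare the numbers of steps there.\<close>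

lemma dyck_paths_iff:
  "P \<in> dyck_paths k n \<longleftrightarrow> count_list P U = k * n \<and> count_list P D = n \<and>
    (\<forall>p q. P = p @ D # q \<longrightarrow> k * Suc (count_list p D) \<le> count_list p U)" (is "_ \<longleftrightarrow> ?R")
proof
  assume P: "P \<in> dyck_paths k n"
  have U: "int (count_list P U) = int (k * count_list P D)"
    using P by (simp add: dyck_paths_def height_eq)
  then have U: "count_list P U = k * count_list P D" by presburger
  then have "(k + 1) * count_list P D = (k + 1) * n"
    using P length_eq_count_steps[of P] by (simp add: dyck_paths_def)
  then have D: "count_list P D = n" by (metis add_is_0 mult_cancel1 one_neq_zero)
  have "k * Suc (count_list p D) \<le> count_list p U" if "P = p @ D # q" for p q
  proof -
    have "0 \<le> height k P (Suc (length p))" using P that by (simp add: dyck_paths_def)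
    also have "\<dots> = int (count_list p U) - int (k * Suc (count_list p D))"
      using that by (simp add: height_eq algebra_simps)
    finally show ?thesis by linarith
  qed
  then show ?R using U D by simp
next
  assume R: ?R
  have "0 \<le> height k P j" if "j \<le> length P" for j
    using that
  proof (induction j)
    case 0
    then show ?case by (simp add: height_def)
  next
    case (Suc j)
    have split: "P = take j P @ P ! j # drop (Suc j) P" using Suc.prems by (simp add: id_take_nth_drop)
    have take: "take (Suc j) P = take j P @ [P ! j]" using Suc.prems by (simp add: take_Suc_conv_app_nth)
    show ?case
    proof (cases "P ! j")
      case U
      then show ?thesis using Suc take by (simp add: height_eq)
    next
      case D
      then have "k * Suc (count_list (take j P) D) \<le> count_list (take j P) U" using R split by metis
      then have "int (k * Suc (count_list (take j P) D)) \<le> int (count_list (take j P) U)" by linarith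
      then show ?thesis using D take by (simp add: height_eq algebra_simps)
    qed
  qed
  then show "P \<in> dyck_paths k n"
    using R length_eq_count_steps[of P] by (simp add: dyck_paths_def height_eq)
qed

lemma dyck_path_hd_last:
  assumes "P \<in> dyck_paths k n" "k \<ge> 1" "n \<ge> 1"
  shows "P \<noteq> []" "hd P = U" "last P = D"
proof -
  show ne: "P \<noteq> []" using assms by (auto simp: dyck_paths_iff)
  show "hd P = U"
  proof (rule ccontr)
    assume "hd P \<noteq> U"
    then have "P = [] @ D # tl P" using ne by (cases P) auto
    then have "k * Suc (count_list [] D) \<le> count_list [] U" using assms(1) unfolding dyck_paths_iff by blast
    then show False using assms(2) by simp
  qed
  show "last P = D"
  proof (rule ccontr)
    assume "last P \<noteq> D"
    then have eq: "P = butlast P @ [U]" using ne by (metis append_butlast_last_id step_neq_iff(2))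
    then have "0 \<le> height k P (length (butlast P))" using assms(1) by (simp add: dyck_paths_def)
    moreover have "take (length (butlast P)) P = butlast P" by (simp add: take_butlast butlast_conv_take)
    moreover have "count_list P U = Suc (count_list (butlast P) U)" "count_list P D = count_list (butlast P) D"
      by (subst eq, simp)+
    ultimately show False using assms(1) by (simp add: height_eq dyck_paths_iff flip: of_nat_mult)
  qed
qed

lemma split_at_occurrence:
  "1 \<le> m \<Longrightarrow> m \<le> count_list w x \<Longrightarrow> \<exists>p q. w = p @ x # q \<and> Suc (count_list p x) = m"
proof (induction w rule: rev_induct)
  case (snoc y w)
  show ?case
  proof (cases "m \<le> count_list w x")
    case True
    then obtain p q where "w = p @ x # q" "Suc (count_list p x) = m" using snoc by blast
    then show ?thesis by (intro exI[of _ p] exI[of _ "q @ [y]"]) simp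
  next
    case False
    then have "y = x" "Suc (count_list w x) = m" using snoc.prems by (auto split: if_splits)
    then show ?thesis by blast
  qed
qed simp

text \<open>The core of the argument: the condition on the first \<open>m\<close> rows, with \<open>a = k m - 1\<close>, says that more
  than \<open>a\<close> up-steps precede the \<open>m\<close>-th down-step. Indeed the last of these up-steps starts a peak,
  and the peaks up to this point are the false bits among the first \<open>m\<close> of \<open>downs D w\<close>.\<close>

lemma prefix_condition_iff:
  assumes w: "w = p @ D # q" "hd w = U" and m: "m = Suc (count_list p D)"
  shows "trues (take a (ups w)) + trues (take m (downs D w)) < m \<longleftrightarrow> a < count_list p U"
proof -
  define p' where "p' = p @ [D]"
  have w': "w = p' @ q" and last: "last p' = D" using w by (simp_all add: p'_def)
  define u where "u = count_list p U"
  have Y: "take m (downs D w) = downs D p'"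
  proof -
    have "downs D w = downs D p' @ downs D q" using downs_append[of p' q] w' last by simp
    moreover have "length (downs D p') = m" using m by (simp add: p'_def)
    ultimately show ?thesis by simp
  qed
  have X: "take u (ups w) = ups p'"
  proof -
    have "ups w = ups p' @ ups q" using ups_append[of p' q] w' last by simp
    moreover have "length (ups p') = u" by (simp add: p'_def u_def)
    ultimately show ?thesis by simp
  qed
  have pU: "p \<noteq> []" "hd p = U" using w by (cases p; auto)+
  then have u: "u > 0" by (cases p) (auto simp: u_def)
  then obtain u' where u': "u = Suc u'" by (cases u) auto
  have len: "u \<le> length (ups w)" using w by (simp add: u_def)
  have len': "length (ups p') = Suc u'" using u' by (simp add: p'_def u_def)
  then have ne: "ups p' \<noteq> []" by (metis list.size(3) nat.distinct(1))
  have "last (ups p') \<longleftrightarrow> ups p' ! u'" by (simp only: last_conv_nth[OF ne] len' diff_Suc_1)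
  also have "\<dots> \<longleftrightarrow> ups w ! u'" unfolding X[symmetric] u' by simp
  finally have "ups w ! u'" using ups_last[OF last ne] by blast
  then have "trues (take a (ups w)) < trues (ups p') \<longleftrightarrow> a < u"
    using trues_take_less_iff[of u' "ups w" a] len u' X by simp
  moreover have "trues (ups p') = count_list (downs D p') False"
    using trues_ups_eq_falses_downs last by blast
  moreover have "trues (downs D p') + count_list (downs D p') False = m"
    using m by (simp add: trues_plus_falses p'_def)
  ultimately show ?thesis using Y by (simp add: u_def) linarith
qed

text \<open>The last bit of \<open>ups P\<close>, which belongs to the rightmost peak, is dropped. The new first bit stands
  for a peak after no up-step, which cannot occur; it makes the index of a bit equal to the number
  of up-steps before the down-step of the peak.\<close>

definition path_pair :: "step list \<Rightarrow> bool list \<times> bool list" where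
  "path_pair P = (False # butlast (ups P), downs D P)"

text \<open>The inverse of \<open>path_pair\<close>.\<close>

definition pair_path :: "bool list \<times> bool list \<Rightarrow> step list" where
  "pair_path = (\<lambda>(V, Y). word (tl V @ [True]) Y)"

lemma path_pair_mem_iff:
  assumes P: "hd P = U" "last P = D" "count_list P U = k * n" "count_list P D = n" and kn: "k \<ge> 1" "n \<ge> 1"
  shows "path_pair P \<in> word_pairs k n \<longleftrightarrow> P \<in> dyck_paths k n"
proof -
  define X Y where "X = ups P" and "Y = downs D P"
  have len: "length X = k * n" "length Y = n" using P by (simp_all add: X_def Y_def)
  have X: "X \<noteq> []" using len kn by auto
  then have Xl: "last X" using ups_last P X_def by blast
  then have Xb: "X = butlast X @ [True]" using X by (metis append_butlast_last_id)
  have take: "take (k * m) (False # butlast X) = False # take (k * m - 1) X" if "m \<in> {1..n}" for m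
  proof -
    have "0 < k * m" "k * m \<le> k * n" using that kn by auto
    moreover from this have "k * m - 1 < length X" using len by linarith
    then have "take (k * m - 1) X = take (k * m - 1) (butlast X)" by (simp add: take_butlast)
    ultimately show ?thesis by (cases "k * m") auto
  qed
  have "trues X = count_list Y False" using trues_ups_eq_falses_downs P by (simp add: X_def Y_def)
  moreover have "trues X = Suc (trues (butlast X))" by (subst Xb) simp
  ultimately have tot: "Suc (trues (False # butlast X) + trues Y) = n"
    using trues_plus_falses[of Y] len by simp
  have "path_pair P \<in> word_pairs k n \<longleftrightarrow>
      (\<forall>m \<in> {1..n}. trues (take (k * m - 1) X) + trues (take m Y) < m)"
    using tot len kn take by (simp add: word_pairs_def path_pair_def X_def[symmetric] Y_def[symmetric])
  also have "\<dots> \<longleftrightarrow> (\<forall>p q. P = p @ D # q \<longrightarrow> k * Suc (count_list p D) \<le> count_list p U)"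
  proof (intro iffI allI impI ballI)
    fix p q 
    assume *: "\<forall>m \<in> {1..n}. trues (take (k * m - 1) X) + trues (take m Y) < m" and pq: "P = p @ D # q"
    then have "Suc (count_list p D) \<in> {1..n}" using P(4) by auto
    then have "trues (take (k * Suc (count_list p D) - 1) X) + trues (take (Suc (count_list p D)) Y)
        < Suc (count_list p D)"
      using * by blast
    then have "k * Suc (count_list p D) - 1 < count_list p U"
      using prefix_condition_iff[OF pq P(1) refl] unfolding X_def Y_def by blast
    then show "k * Suc (count_list p D) \<le> count_list p U" by linarith
  next
    fix m assume *: "\<forall>p q. P = p @ D # q \<longrightarrow> k * Suc (count_list p D) \<le> count_list p U" and m: "m \<in> {1..n}"
    then obtain p q where pq: "P = p @ D # q" "m = Suc (count_list p D)"
      using split_at_occurrence[of m P D] P(4) by auto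
    then have "k * m \<le> count_list p U" using * by blast
    moreover have "k * m > 0" using m kn by simp
    ultimately have "k * m - 1 < count_list p U" by linarith
    then show "trues (take (k * m - 1) X) + trues (take m Y) < m"
      using prefix_condition_iff[OF pq(1) P(1) pq(2)] by (simp add: X_def Y_def)
  qed
  finally show ?thesis using P by (simp add: dyck_paths_iff)
qed

lemma bij_betw_path_pair:
  assumes kn: "k \<ge> 1" "n \<ge> 1"
  shows "bij_betw path_pair (dyck_paths k n) (word_pairs k n)"
proof (rule bij_betw_byWitness[where f' = pair_path])
  show "\<forall>P \<in> dyck_paths k n. pair_path (path_pair P) = P"
  proof
    fix P assume P: "P \<in> dyck_paths k n"
    note hl = dyck_path_hd_last[OF P kn]
    have "ups P \<noteq> []" using hl by (cases P) auto
    then have "butlast (ups P) @ [True] = ups P" using ups_last[of P] hl by (metis append_butlast_last_id)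
    then show "pair_path (path_pair P) = P" using hl word_ups_downs by (simp add: path_pair_def pair_path_def)
  qed
  show "path_pair ` dyck_paths k n \<subseteq> word_pairs k n"
  proof
    fix x assume "x \<in> path_pair ` dyck_paths k n"
    then obtain P where P: "P \<in> dyck_paths k n" "x = path_pair P" by blast
    then show "x \<in> word_pairs k n"
      using path_pair_mem_iff[of P k n] dyck_path_hd_last[of P k n] kn by (simp add: dyck_paths_iff)
  qed
  have inv: "pair_path (V, Y) \<in> dyck_paths k n \<and> path_pair (pair_path (V, Y)) = (V, Y)"
    if VY: "(V, Y) \<in> word_pairs k n" for V Y
  proof -
    define P where "P = pair_path (V, Y)"
    have len: "length V = k * n" "length Y = n" and tot: "Suc (trues V + trues Y) = n"
      and one: "trues (take k V) + trues (take 1 Y) < 1"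
      using VY kn by (auto simp: word_pairs_def dest: bspec[where x = 1])
    \<comment> \<open>The condition for \<open>m = 1\<close> says that the first row has no true bit.\<close>
    obtain V' where V: "V = False # V'"
    proof (cases V)
      case Nil
      then show ?thesis using len kn by simp
    next
      case (Cons a V')
      then show ?thesis using one kn that by (cases k; cases a) auto
    qed
    obtain Y' where Y: "Y = False # Y'"
    proof (cases Y)
      case Nil
      then show ?thesis using len kn by simp
    next
      case (Cons a Y')
      then show ?thesis using one that by (cases a) auto
    qed
    have "trues (V' @ [True]) = count_list Y False"
      using tot len trues_plus_falses[of Y] V by simp
    then have P: "ups P = V' @ [True]" "downs D P = Y" "P = [] \<or> last P = D"
      using word_inverse[of "V' @ [True]" Y] V by (auto simp: P_def pair_path_def)
    have hd: "hd P = U" using P(2) Y by (cases P rule: ups.cases) auto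
    have ne: "P \<noteq> []" using P(1) by auto
    have pp: "path_pair P = (V, Y)" using P V by (simp add: path_pair_def)
    have "count_list P U = k * n" "count_list P D = n"
      using length_ups[of P] length_downs[of D P] P len V by auto
    then have "P \<in> dyck_paths k n"
      using path_pair_mem_iff[of P k n] hd P(3) ne kn pp VY by simp
    then show ?thesis using pp P_def by simp
  qed
  show "\<forall>x \<in> word_pairs k n. path_pair (pair_path x) = x" using inv by auto
  show "pair_path ` word_pairs k n \<subseteq> dyck_paths k n" using inv by auto
qed

section \<open>The statistics of a path\<close>

lemma dd_eq_trues_downs:
  assumes "hd P = U"
  shows "dd P = trues (downs D P)"
proof -
  have "trues (downs s w) = of_bool (s = D \<and> w \<noteq> [] \<and> hd w = D) + dd w" for s w
  proof (induction s w rule: downs.induct)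
    case (1 s)
    then show ?case by (simp add: dd_def)
  next
    case (2 s w)
    have "dd (U # w) = dd w"
      unfolding dd_def by (subst card_Collect_zero_Suc) auto
    then show ?case using 2 by simp
  next
    case (3 s w)
    have "dd (D # w) = of_bool (w \<noteq> [] \<and> hd w = D) + dd w"
    proof (cases w)
      case Cons
      then show ?thesis unfolding dd_def by (subst card_Collect_zero_Suc) auto
    qed (simp add: dd_def)
    then show ?case using 3 by simp
  qed
  from this[of D P] show ?thesis using assms by simp
qed

text \<open>The peaks correspond to the true bits of \<open>ups w\<close> by counting the up-steps before the peak.\<close>

lemma card_peaks_eq_card_ups:
  "card {j. j \<in> peaks w \<and> Q (count_list (take j w) U)} = card {v. v < count_list w U \<and> ups w ! v \<and> Q v}"
proof (induction w arbitrary: Q rule: ups.induct)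
  case 1
  then show ?case by (simp add: peaks_def)
next
  case (2 w)
  have fin: "finite {j. j \<in> peaks (D # w) \<and> Q (count_list (take j (D # w)) U)}" by (simp add: peaks_def)
  show ?case using 2[of Q] by (subst card_Collect_zero_Suc[OF fin]) (simp add: peaks_def)
next
  case (3 w)
  have fin: "finite {j. j \<in> peaks (U # w) \<and> Q (count_list (take j (U # w)) U)}" by (simp add: peaks_def)
  show ?case using 3[of "\<lambda>v. Q (Suc v)"]
    by (subst card_Collect_zero_Suc[OF fin], subst card_Collect_zero_Suc) (auto simp: peaks_def hd_conv_nth)
qed

lemma peaks_nonempty: "last w = D \<Longrightarrow> U \<in> set w \<Longrightarrow> \<exists>j. j \<in> peaks w"
proof (induction w)
  case (Cons s w)
  show ?case
  proof (cases "U \<in> set w")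
    case True
    then obtain j where "j \<in> peaks w" using Cons by (auto split: if_splits)
    then have "Suc j \<in> peaks (s # w)" by (simp add: peaks_def)
    then show ?thesis by blast
  next
    case False
    then have s: "s = U" "w \<noteq> []" using Cons.prems by (auto split: if_splits)
    then have "w ! 0 \<in> set w" by simp
    then have "w ! 0 = D" using False by (metis step.exhaust)
    then have "0 \<in> peaks (s # w)" using s by (simp add: peaks_def)
    then show ?thesis by blast
  qed
qed simp

text \<open>In a path that ends in a down-step, a peak is the rightmost one iff it uses the last up-step.\<close>

lemma later_peak_iff:
  assumes "last P = D" "j \<in> peaks P"
  shows "(\<exists>j' \<in> peaks P. j < j') \<longleftrightarrow> Suc (count_list (take j P) U) < count_list P U"
proof -
  have take: "count_list (take (Suc j) P) U = Suc (count_list (take j P) U)"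
    using assms(2) by (simp add: peaks_def take_Suc_conv_app_nth)
  have total: "count_list P U = count_list (take i P) U + count_list (drop i P) U" for i
    by (metis append_take_drop_id count_list_append)
  show ?thesis
  proof
    assume "\<exists>j' \<in> peaks P. j < j'"
    then obtain j' where j': "j' \<in> peaks P" "j < j'" by blast
    then have "count_list (take (Suc j) P) U \<le> count_list (take j' P) U"
      by (intro count_list_take_mono) simp
    also have "\<dots> < count_list (take (Suc j') P) U"
      using j'(1) by (simp add: peaks_def take_Suc_conv_app_nth)
    also have "\<dots> \<le> count_list P U" using total[of "Suc j'"] by simp
    finally show "Suc (count_list (take j P) U) < count_list P U" using take by simp
  next
    assume "Suc (count_list (take j P) U) < count_list P U"
    then have "count_list (drop (Suc j) P) U \<noteq> 0" using total[of "Suc j"] take by simp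
    then have "U \<in> set (drop (Suc j) P)" by (simp add: count_list_0_iff)
    moreover have "last (drop (Suc j) P) = D" using assms by (simp add: peaks_def)
    ultimately obtain i where "i \<in> peaks (drop (Suc j) P)" using peaks_nonempty by blast
    then have "Suc j + i \<in> peaks P" using assms(2) by (auto simp: peaks_def)
    then show "\<exists>j' \<in> peaks P. j < j'" by (intro bexI[of _ "Suc j + i"]) auto
  qed
qed

lemma pk_eq_card:
  assumes P: "P \<in> dyck_paths k n" and kn: "k \<ge> 1" "n \<ge> 1" and i: "i < k"
  shows "pk k i P = card {v. v < k * n \<and> (False # butlast (ups P)) ! v \<and> v mod k = i}"
proof -
  note hl = dyck_path_hd_last[OF P kn]
  have N: "count_list P U = k * n" using P by (simp add: dyck_paths_iff)
  have "[height k P (j + 1) = int i] (mod int k) \<longleftrightarrow> Suc (count_list (take j P) U) mod k = i"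
    if "j \<in> peaks P" for j
  proof -
    let ?v = "Suc (count_list (take j P) U)" 
    have "height k P (j + 1) = int ?v - int k * int (count_list (take (Suc j) P) D)"
      using that by (simp add: height_eq peaks_def take_Suc_conv_app_nth)
    then have "height k P (j + 1) mod int k = int ?v mod int k"
      by (metis mod_diff_right_eq mod_mult_self1_is_0 diff_zero)
    also have "\<dots> = int (?v mod k)" by (simp add: zmod_int)
    finally show ?thesis using i by (simp add: cong_def)
  qed
  then have "pk k i P = card {j. j \<in> peaks P \<and> (Suc (count_list (take j P) U) < k * n \<and>
      Suc (count_list (take j P) U) mod k = i)}"
    unfolding pk_def using later_peak_iff[OF hl(3)] N by (intro arg_cong[where f = card]) auto
  also have "\<dots> = card {v. v < k * n \<and> ups P ! v \<and> (Suc v < k * n \<and> Suc v mod k = i)}"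
    using card_peaks_eq_card_ups[of P "\<lambda>v. Suc v < k * n \<and> Suc v mod k = i"] N by simp
  also have "\<dots> = card {v. Suc v < k * n \<and> (False # butlast (ups P)) ! Suc v \<and> Suc v mod k = i}"
    using N by (intro arg_cong[where f = card]) (auto simp: nth_butlast)
  also have "\<dots> = card {v. v < k * n \<and> (False # butlast (ups P)) ! v \<and> v mod k = i}"
    by (subst (2) card_Collect_zero_Suc) auto
  finally show ?thesis .
qed

section \<open>Equidistribution\<close>

theorem theorem2p7:
  fixes k n :: nat and r :: "nat list"
  assumes "k \<ge> 1" and "n \<ge> 1" and "length r = k + 1"
  shows "card {P \<in> dyck_paths k n. map (\<lambda>i. pk k i P) [0..<k] @ [dd P] = r}
       = card {T \<in> lary_trees (k + 1) n. map (\<lambda>i. children_at i T) [1..<k + 2] = r}"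
proof -
  let ?columns = "\<lambda>bs. map (\<lambda>i. column i bs) [0..<Suc k]"
  let ?encode = "(\<lambda>(V, Y). rows k V Y) \<circ> path_pair"
  have "card {P \<in> dyck_paths k n. map (\<lambda>i. pk k i P) [0..<k] @ [dd P] = r}
      = card {bs \<in> codes (Suc k) n. ?columns bs = r}"
  proof (rule card_eq_of_bij_betw_stat)
    show "bij_betw ?encode (dyck_paths k n) (codes (Suc k) n)"
      using assms by (intro bij_betw_trans[OF bij_betw_path_pair bij_betw_rows])
  next
    fix P assume P: "P \<in> dyck_paths k n"
    note hl = dyck_path_hd_last[OF P assms(1,2)]
    have len: "length (downs D P) = n" "length (False # butlast (ups P)) = k * length (downs D P)"
      using P assms by (auto simp: dyck_paths_iff)
    show "?columns (?encode P) = map (\<lambda>i. pk k i P) [0..<k] @ [dd P]"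
      using column_rows[OF len(2)] column_last_rows[OF len(2)] len(1)
        pk_eq_card[OF P assms(1,2)] dd_eq_trues_downs[OF hl(2)]
      by (simp add: path_pair_def)
  qed
  also have "\<dots> = card {T \<in> lary_trees (Suc k) n. map (\<lambda>i. children_at i T) [1..<k + 2] = r}"
  proof (rule card_eq_of_bij_betw_stat[OF bij_betw_code, symmetric])
    fix T assume "T \<in> lary_trees (Suc k) n"
    then have "column i (code T) = children_at (Suc i) T" if "i < Suc k" for i
      using column_code[of "Suc k" T i] that unfolding lary_trees_def by blast
    moreover have "[1..<k + 2] = map Suc [0..<Suc k]" by (simp only: map_Suc_upt) simp
    ultimately show "?columns (code T) = map (\<lambda>i. children_at i T) [1..<k + 2]"
      by (simp only: map_map) (auto simp: comp_def)
  qed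
  finally show ?thesis by simp
qed

end
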